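(* Consider an ExpRK-F method (exponential Runge-Kutta method with fixed equilibrium function $\tilde M$), as defined in the context, for the Boltzmann equation $\partial_t f+v\cdot\nabla_x f=\frac1\varepsilon Q(f,f)$, and suppose that $\beta_{ij}\ge 0$, where $\beta_{ij}=\alpha_{ij}(c_i-c_j)$ are the coefficients of the Shu-Osher representation of the underlying explicit Runge-Kutta method. Under the assumption on the transport term stated in the context, there exist $h_*>0$ and $\mu_*>0$ such that $f^{n+1}\ge 0$ provided that $f^n\ge 0$, $\mu\ge\mu_*$ and $0<h\le h_*$.
   Context: Boltzmann operator. For $f=f(t,x,v)$, $x,v\in\mathbb{R}^d$, $Q(f,f)=Q^+-f\,Q^-=\int_{S^{d-1}}\int_{\mathbb{R}^d}(f'f'_*-ff_* )\,B(|v-v_*|,\omega)\,dv_*\,d\omega$, where $B$ is the collision kernel, $f_*=f(t,x,v_* )$, $f'=f(t,x,v')$, $f'_*=f(t,x,v'_* )$, $v'=v-\frac12(g-|g|\omega)$, $v'_*=v_*+\frac12(g-|g|\omega)$, $g=v-v_*$. Here $\varepsilon>0$ is the Knudsen number. For a constant $\mu>0$ put $P(f)=Q(f,f)+\mu f$. Runge-Kutta coefficients. An explicit $\nu$-stage Runge-Kutta method has coefficients $a_{ij}$ ($1\le j<i\le\nu$), $b_i$ ($1\le i\le\nu$), $c_i=\sum_{j=1}^{i-1}a_{ij}$, $\sum_i b_i=1$. Put $a_{\nu+1,j}=b_j$ and $c_{\nu+1}=1$. Shu-Osher representation. Coefficients $\alpha_{ij},\beta_{ij}$ ($1\le j<i\le\nu+1$,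 $i\ge2$) with $\sum_{j=1}^{i-1}\alpha_{ij}=1$ and $\beta_{ij}=\alpha_{ij}(c_i-c_j)$, such that $a_{ij}=\beta_{ij}+\sum_{k=j+1}^{i-1}\alpha_{ik}a_{kj}$; thus the Runge-Kutta method for $y'=F(t,y)$ with step $h$ can be written $y^{(1)}=y^n$, $y^{(i)}=\sum_{j=1}^{i-1}\left[\alpha_{ij}y^{(j)}+h\beta_{ij}F(t^n+c_jh,y^{(j)})\right]$ for $2\le i\le\nu+1$, with $y^{n+1}=y^{(\nu+1)}$. ExpRK-F scheme. Let $\tilde M$ be a given nonnegative function (the equilibrium function) that does not depend on time during the step, $h>0$ the time step, $\lambda=\mu h/\varepsilon$. Given $f^n$, the stages $f^{(i)}$ ($1\le i\le\nu$) and $f^{n+1}$ are defined by $$(f^{(i)}-\tilde M)e^{c_i\lambda}=(f^n-\tilde M)+\sum_{j=1}^{i-1}a_{ij}\frac h\varepsilon\left[P(f^{(j)})-\mu\tilde M-\varepsilon v\cdot\nabla_xf^{(j)}\right]e^{c_j\lambda},$$ $$(f^{n+1}-\tilde M)e^{\lambda}=(f^n-\tilde M)+\sum_{i=1}^{\nu}b_i\frac h\varepsilon\left[P(f^{(i)})-\mu\tilde M-\varepsilon v\cdot\nabla_xf^{(i)}\right]e^{c_i\lambda}.$$ Assumption on the transport term. For a given $f\ge0$ there exists $h^*>0$ such that $f-h\,v\cdot\nabla_xf\ge0$ for all $0<h\le h^*$.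
   Formalization: Formal version also assumes α_ij ≥ 0, B ≥ 0, that the collision integrals and v·∇_x f exist for the stages, and that the stages lie in a class with one common transport threshold h* and uniformly bounded collision frequency Q^-; h_*, μ_* depend on that class. *)

theory Defs
  imports "HOL-Analysis.Analysis"
begin

text \<open>
  Phase-space functions at a fixed time are curried: \<open>f x v\<close> with position \<open>x\<close> and velocity \<open>v\<close>
  in a Euclidean space of dimension \<open>d = DIM('a)\<close>.
\<close>

type_synonym 'a phase = "'a \<Rightarrow> 'a \<Rightarrow> real"

definition nonneg :: "'a phase \<Rightarrow> bool" where
  "nonneg f \<longleftrightarrow> (\<forall>x v. 0 \<le> f x v)"

text \<open>
  Surface measure on the unit sphere, as the cone measure
  \<open>\<sigma>(A) = d * vol {r \<omega> | 0 < r \<le> 1, \<omega> \<in> A}\<close>; for \<open>d = 1\<close> it is the counting measure on \<open>{-1, 1}\<close>.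
\<close>

definition sphere_measure :: "'a::euclidean_space measure" where
  "sphere_measure =
     scale_measure (of_nat DIM('a))
       (distr (restrict_space lborel (cball 0 1 - {0})) (restrict_space borel (sphere 0 1))
         (\<lambda>y. y /\<^sub>R norm y))"

lemma space_sphere_measure: "space (sphere_measure :: 'a::euclidean_space measure) = sphere 0 1"
  by (simp add: sphere_measure_def space_scale_measure space_restrict_space)

lemma sets_sphere_measure:
  "sets (sphere_measure :: 'a::euclidean_space measure) = sets (restrict_space borel (sphere 0 1))"
  by (simp add: sphere_measure_def)

lemma emeasure_sphere_measure:
  fixes A :: "'a::euclidean_space set"
  assumes "A \<in> sets borel" "A \<subseteq> sphere 0 1"
  shows "emeasure sphere_measure A =
    of_nat DIM('a) * emeasure lborel {y \<in> cball 0 1 - {0}. y /\<^sub>R norm y \<in> A}"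
proof -
  let ?g = "\<lambda>y::'a. y /\<^sub>R norm y"
  have g: "?g \<in> borel_measurable borel" by measurable
  have m: "?g \<in> measurable (restrict_space lborel (cball 0 1 - {0})) (restrict_space borel (sphere 0 1))"
  proof (rule measurable_restrict_space3)
    show "?g \<in> measurable lborel borel" using g by simp
    show "?g \<in> (cball 0 1 - {0}) \<rightarrow> sphere 0 1" by auto
  qed
  have A: "A \<in> sets (restrict_space borel (sphere 0 1))"
    using assms by (subst sets_restrict_space_iff) auto
  have eq: "?g -` A \<inter> space (restrict_space lborel (cball 0 1 - {0})) =
      {y \<in> cball 0 1 - {0}. ?g y \<in> A}"
    by (auto simp: space_restrict_space)
  show ?thesis
    unfolding sphere_measure_def emeasure_scale_measure emeasure_distr[OF m A] eq
    by (subst emeasure_restrict_space) auto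
qed

definition post_v :: "'a::euclidean_space \<Rightarrow> 'a \<Rightarrow> 'a \<Rightarrow> 'a" where
  "post_v v vs \<omega> = v - (1/2) *\<^sub>R ((v - vs) - norm (v - vs) *\<^sub>R \<omega>)"

definition post_vs :: "'a::euclidean_space \<Rightarrow> 'a \<Rightarrow> 'a \<Rightarrow> 'a" where
  "post_vs v vs \<omega> = vs + (1/2) *\<^sub>R ((v - vs) - norm (v - vs) *\<^sub>R \<omega>)"

definition collision_Q :: "(real \<Rightarrow> 'a \<Rightarrow> real) \<Rightarrow> 'a::euclidean_space phase \<Rightarrow> 'a phase" where
  "collision_Q B f x v =
     (LINT (vs, \<omega>) | (lborel \<Otimes>\<^sub>M sphere_measure).
        (f x (post_v v vs \<omega>) * f x (post_vs v vs \<omega>) - f x v * f x vs) * B (norm (v - vs)) \<omega>)"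

text \<open>The collision frequency \<open>Q\<^sup>-\<close> in \<open>Q(f,f) = Q\<^sup>+ - f Q\<^sup>-\<close>.\<close>

definition loss_Q :: "(real \<Rightarrow> 'a \<Rightarrow> real) \<Rightarrow> 'a::euclidean_space phase \<Rightarrow> 'a phase" where
  "loss_Q B f x v =
     (LINT (vs, \<omega>) | (lborel \<Otimes>\<^sub>M sphere_measure). f x vs * B (norm (v - vs)) \<omega>)"

definition P_op :: "(real \<Rightarrow> 'a \<Rightarrow> real) \<Rightarrow> real \<Rightarrow> 'a::euclidean_space phase \<Rightarrow> 'a phase" where
  "P_op B \<mu> f x v = collision_Q B f x v + \<mu> * f x v"

text \<open>
  \<open>v \<bullet> \<nabla>\<^sub>x f\<close>, as the derivative of \<open>f(\<cdot>, v)\<close> at \<open>x\<close> applied to \<open>v\<close>.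
\<close>

definition transport :: "'a::euclidean_space phase \<Rightarrow> 'a phase" where
  "transport f x v = frechet_derivative (\<lambda>y. f y v) (at x) v"

text \<open>
  Functions for which \<open>v \<bullet> \<nabla>\<^sub>x f\<close> and both parts of the collision integral are genuinely defined
  (otherwise the derivative is arbitrary and a divergent integral is \<open>0\<close>).
\<close>

definition regular :: "(real \<Rightarrow> 'a \<Rightarrow> real) \<Rightarrow> 'a::euclidean_space phase \<Rightarrow> bool" where
  "regular B f \<longleftrightarrow>
     (\<forall>x v. (\<lambda>y. f y v) differentiable (at x)) \<and>
     (\<forall>x v. integrable (lborel \<Otimes>\<^sub>M sphere_measure)
        (\<lambda>(vs, \<omega>). f x (post_v v vs \<omega>) * f x (post_vs v vs \<omega>) * B (norm (v - vs)) \<omega>)) \<and>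
     (\<forall>x v. integrable (lborel \<Otimes>\<^sub>M sphere_measure)
        (\<lambda>(vs, \<omega>). f x vs * B (norm (v - vs)) \<omega>))"

text \<open>
  The transport assumption on a class \<open>\<F>\<close> of functions; the threshold is common to the class
  because it is needed for Runge-Kutta stages, which themselves depend on the step size.
\<close>

definition transport_assumption :: "'a::euclidean_space phase set \<Rightarrow> bool" where
  "transport_assumption \<F> \<longleftrightarrow>
     (\<exists>h0>0. \<forall>f\<in>\<F>. nonneg f \<longrightarrow>
        (\<forall>h. 0 < h \<and> h \<le> h0 \<longrightarrow> nonneg (\<lambda>x v. f x v - h * transport f x v)))"

text \<open>
  Stages are numbered \<open>1, \<dots>, \<nu>\<close>; only the entries \<open>a i j\<close> with \<open>1 \<le> j < i \<le> \<nu>\<close> and \<open>b i\<close> with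
  \<open>1 \<le> i \<le> \<nu>\<close> are relevant. In \<open>ext_a\<close> and \<open>ext_c\<close> the update is row \<open>\<nu> + 1\<close>.
\<close>

definition ext_a :: "nat \<Rightarrow> (nat \<Rightarrow> nat \<Rightarrow> real) \<Rightarrow> (nat \<Rightarrow> real) \<Rightarrow> nat \<Rightarrow> nat \<Rightarrow> real" where
  "ext_a \<nu> a b i j = (if i = \<nu> + 1 then b j else a i j)"

definition ext_c :: "nat \<Rightarrow> (nat \<Rightarrow> nat \<Rightarrow> real) \<Rightarrow> nat \<Rightarrow> real" where
  "ext_c \<nu> a i = (if i = \<nu> + 1 then 1 else (\<Sum>j\<in>{1..<i}. a i j))"

definition shu_osher ::
  "nat \<Rightarrow> (nat \<Rightarrow> nat \<Rightarrow> real) \<Rightarrow> (nat \<Rightarrow> real) \<Rightarrow> (nat \<Rightarrow> nat \<Rightarrow> real) \<Rightarrow> (nat \<Rightarrow> nat \<Rightarrow> real) \<Rightarrow> bool" where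
  "shu_osher \<nu> a b \<alpha> \<beta> \<longleftrightarrow>
     (\<forall>i\<in>{2..\<nu>+1}.
        (\<Sum>j\<in>{1..<i}. \<alpha> i j) = 1 \<and>
        (\<forall>j\<in>{1..<i}.
           \<beta> i j = \<alpha> i j * (ext_c \<nu> a i - ext_c \<nu> a j) \<and>
           ext_a \<nu> a b i j = \<beta> i j + (\<Sum>k\<in>{j+1..<i}. \<alpha> i k * ext_a \<nu> a b k j)))"

text \<open>
  One step of the exponential Runge-Kutta method with fixed equilibrium function \<open>M\<close>:
  \<open>fn\<close> is the old value, \<open>F 1, \<dots>, F \<nu>\<close> are the stages and \<open>fn1\<close> is the new value.
\<close>

definition ExpRKF_step ::
  "nat \<Rightarrow> (nat \<Rightarrow> nat \<Rightarrow> real) \<Rightarrow> (nat \<Rightarrow> real) \<Rightarrow> (real \<Rightarrow> 'a \<Rightarrow> real) \<Rightarrow> 'a::euclidean_space phase \<Rightarrow>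
    real \<Rightarrow> real \<Rightarrow> real \<Rightarrow> 'a phase \<Rightarrow> (nat \<Rightarrow> 'a phase) \<Rightarrow> 'a phase \<Rightarrow> bool" where
  "ExpRKF_step \<nu> a b B M \<epsilon> \<mu> h fn F fn1 \<longleftrightarrow>
     (let c = ext_c \<nu> a; lam = \<mu> * h / \<epsilon>;
          G = (\<lambda>j x v. P_op B \<mu> (F j) x v - \<mu> * M x v - \<epsilon> * transport (F j) x v)
      in (\<forall>i\<in>{1..\<nu>}. \<forall>x v.
            (F i x v - M x v) * exp (c i * lam) =
              (fn x v - M x v) + (\<Sum>j\<in>{1..<i}. a i j * (h / \<epsilon>) * G j x v * exp (c j * lam))) \<and>
         (\<forall>x v.
            (fn1 x v - M x v) * exp lam =
              (fn x v - M x v) + (\<Sum>i\<in>{1..\<nu>}. b i * (h / \<epsilon>) * G i x v * exp (c i * lam))))"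

end

theory Submission imports Defs begin

text \<open>
  In the variable \<open>w\<^sub>i = (f\<^sub>i - M) e\<^bsup>c\<^sub>i\<lambda>\<^esup>\<close> the method is an ordinary explicit Runge-Kutta method, so it
  has a Shu-Osher form: each \<open>w\<^sub>i\<close> is a combination, with weights \<open>\<alpha>\<^sub>i\<^sub>j\<close> summing to one, of forward
  Euler steps of length \<open>(c\<^sub>i - c\<^sub>j) h\<close> from the earlier stages (\<open>shu_osher_form\<close>). Going back to \<open>f\<^sub>i\<close>
  collects the terms in \<open>M\<close> and leaves

  \<open>e\<^bsup>c\<^sub>i\<lambda>\<^esup> f\<^sub>i = M (e\<^bsup>c\<^sub>i\<lambda>\<^esup> - \<Sum>\<^sub>j \<alpha>\<^sub>i\<^sub>j e\<^bsup>c\<^sub>j\<lambda>\<^esup> (1 + (c\<^sub>i - c\<^sub>j) \<lambda>))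
     + \<Sum>\<^sub>j e\<^bsup>c\<^sub>j\<lambda>\<^esup> (\<alpha>\<^sub>i\<^sub>j f\<^sub>j - h \<beta>\<^sub>i\<^sub>j v \<bullet> \<nabla>f\<^sub>j + (h / \<epsilon>) \<beta>\<^sub>i\<^sub>j P(f\<^sub>j))\<close>.

  All terms are nonnegative if the earlier stages are. The coefficient of \<open>M\<close> is an average of
  \<open>e\<^bsup>c\<^sub>j\<lambda>\<^esup> (e\<^sup>y - 1 - y)\<close> with \<open>y = (c\<^sub>i - c\<^sub>j) \<lambda>\<close>, and \<open>e\<^sup>y \<ge> 1 + y\<close> (\<open>equilibrium_weight_nonneg\<close>).
  The transport part is \<open>\<alpha>\<^sub>i\<^sub>j\<close> times a transport step of length \<open>(c\<^sub>i - c\<^sub>j) h\<close>, which the assumption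
  on the transport term covers once \<open>h\<close> is small compared with the largest difference \<open>c\<^sub>i - c\<^sub>j\<close>
  (\<open>transport_stage_nonneg\<close>). Finally \<open>P(f) = Q\<^sup>+ + (\<mu> - Q\<^sup>-) f\<close>, so \<open>\<mu>\<close> only has to dominate the
  collision frequency (\<open>P_op_nonneg\<close>). Induction over the stages, with the update counted as stage
  \<open>\<nu> + 1\<close>, finishes the proof.
\<close>

section \<open>The collision operator\<close>

lemma collision_Q_eq_gain_minus_loss:
  assumes "regular B f"
  shows "collision_Q B f x v =
    (LINT (vs, \<omega>) | (lborel \<Otimes>\<^sub>M sphere_measure).
       f x (post_v v vs \<omega>) * f x (post_vs v vs \<omega>) * B (norm (v - vs)) \<omega>) - f x v * loss_Q B f x v"
proof -
  let ?N = "lborel \<Otimes>\<^sub>M sphere_measure :: ('a \<times> 'a) measure"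
  let ?gain = "\<lambda>(vs, \<omega>). f x (post_v v vs \<omega>) * f x (post_vs v vs \<omega>) * B (norm (v - vs)) \<omega>"
  let ?freq = "\<lambda>(vs, \<omega>). f x vs * B (norm (v - vs)) \<omega>"
  have gain: "integrable ?N ?gain" and freq: "integrable ?N ?freq"
    using assms by (auto simp: regular_def)
  have "collision_Q B f x v = (LINT p|?N. ?gain p - f x v * ?freq p)"
    unfolding collision_Q_def
    by (rule Bochner_Integration.integral_cong) (auto simp: algebra_simps)
  also have "\<dots> = (LINT p|?N. ?gain p) - (LINT p|?N. f x v * ?freq p)"
    using gain freq by (intro Bochner_Integration.integral_diff) simp_all
  also have "\<dots> = (LINT p|?N. ?gain p) - f x v * loss_Q B f x v"
    by (simp add: loss_Q_def)
  finally show ?thesis .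
qed

text \<open>
  The gain is nonnegative, and the loss \<open>f Q\<^sup>-\<close> is absorbed by \<open>\<mu> f\<close>.
\<close>

lemma P_op_nonneg:
  assumes kernel: "\<And>r \<omega>. r \<ge> 0 \<Longrightarrow> norm \<omega> = 1 \<Longrightarrow> B r \<omega> \<ge> 0"
    and reg: "regular B f" and f: "nonneg f" and loss: "loss_Q B f x v \<le> \<mu>"
  shows "0 \<le> P_op B \<mu> f x v"
proof -
  have f0: "0 \<le> f x u" for u
    using f by (simp add: nonneg_def)
  have gain: "0 \<le> (LINT (vs, \<omega>) | (lborel \<Otimes>\<^sub>M sphere_measure).
       f x (post_v v vs \<omega>) * f x (post_vs v vs \<omega>) * B (norm (v - vs)) \<omega>)"
    by (rule Bochner_Integration.integral_nonneg)
      (auto simp: space_pair_measure space_sphere_measure intro!: mult_nonneg_nonneg f0 kernel)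
  have "0 \<le> (\<mu> - loss_Q B f x v) * f x v"
    using loss f0 by simp
  with gain show ?thesis
    unfolding P_op_def collision_Q_eq_gain_minus_loss[OF reg] by (simp add: algebra_simps)
qed

section \<open>Shu-Osher form of the scheme\<close>

text \<open>
  Substituting the Butcher form of \<open>w\<^sub>j\<close> into \<open>\<Sum>\<^sub>j \<alpha>\<^sub>i\<^sub>j w\<^sub>j\<close> and exchanging the order of summation
  produces exactly the part \<open>\<Sum>\<^sub>j \<alpha>\<^sub>i\<^sub>j a\<^sub>j\<^sub>k\<close> by which \<open>a\<^sub>i\<^sub>k\<close> differs from \<open>\<beta>\<^sub>i\<^sub>k\<close>.
\<close>

lemma shu_osher_form:
  fixes w K :: "nat \<Rightarrow> real"
  assumes so: "shu_osher \<nu> a b \<alpha> \<beta>"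
    and w: "\<And>i. i \<in> {1..\<nu>+1} \<Longrightarrow> w i = w0 + (\<Sum>j\<in>{1..<i}. ext_a \<nu> a b i j * K j)"
    and i: "i \<in> {2..\<nu>+1}"
  shows "w i = (\<Sum>j\<in>{1..<i}. \<alpha> i j * w j + \<beta> i j * K j)"
proof -
  let ?A = "ext_a \<nu> a b"
  have \<alpha>1: "(\<Sum>j\<in>{1..<i}. \<alpha> i j) = 1"
    and A: "\<And>j. j \<in> {1..<i} \<Longrightarrow> ?A i j = \<beta> i j + (\<Sum>k\<in>{j+1..<i}. \<alpha> i k * ?A k j)"
    using so i unfolding shu_osher_def by blast+
  have "(\<Sum>j\<in>{1..<i}. \<alpha> i j * w j)
      = (\<Sum>j\<in>{1..<i}. \<alpha> i j * w0 + (\<Sum>k\<in>{1..<j}. \<alpha> i j * ?A j k * K k))"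
  proof (rule sum.cong)
    fix j assume "j \<in> {1..<i}"
    then have "w j = w0 + (\<Sum>k\<in>{1..<j}. ?A j k * K k)"
      using i by (intro w) auto
    then show "\<alpha> i j * w j = \<alpha> i j * w0 + (\<Sum>k\<in>{1..<j}. \<alpha> i j * ?A j k * K k)"
      by (simp add: sum_distrib_left algebra_simps)
  qed simp
  also have "\<dots> = w0 + (\<Sum>j\<in>{1..<i}. \<Sum>k\<in>{1..<j}. \<alpha> i j * ?A j k * K k)"
    by (simp only: sum.distrib sum_distrib_right[symmetric] \<alpha>1 mult_1)
  also have "(\<Sum>j\<in>{1..<i}. \<Sum>k\<in>{1..<j}. \<alpha> i j * ?A j k * K k)
      = (\<Sum>k\<in>{1..<i}. \<Sum>j\<in>{k+1..<i}. \<alpha> i j * ?A j k * K k)"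
    by (subst (1 2) sum.Sigma)
      (auto intro!: sum.reindex_bij_witness[of _ prod.swap prod.swap])
  also have "\<dots> = (\<Sum>k\<in>{1..<i}. (?A i k - \<beta> i k) * K k)"
    by (intro sum.cong) (auto simp: A sum_distrib_right)
  also have "\<dots> = (\<Sum>k\<in>{1..<i}. ?A i k * K k) - (\<Sum>k\<in>{1..<i}. \<beta> i k * K k)"
    by (simp add: left_diff_distrib sum_subtractf)
  finally have "(\<Sum>j\<in>{1..<i}. \<alpha> i j * w j) + (\<Sum>j\<in>{1..<i}. \<beta> i j * K j)
      = w0 + (\<Sum>k\<in>{1..<i}. ?A i k * K k)"
    by simp
  also have "\<dots> = w i"
    using i by (intro w[symmetric]) auto
  finally show ?thesis
    by (simp add: sum.distrib)
qed

text \<open>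
  The two clauses of the scheme become one family of equations when the new value is counted as
  stage \<open>\<nu> + 1\<close>; this is what the Shu-Osher form and the induction over the stages refer to.
\<close>

lemma ExpRKF_step_stage:
  assumes step: "ExpRKF_step \<nu> a b B M \<epsilon> \<mu> h fn F fn1" and i: "i \<in> {1..\<nu>+1}"
  shows "((F(\<nu>+1 := fn1)) i x v - M x v) * exp (ext_c \<nu> a i * (\<mu> * h / \<epsilon>)) =
    (fn x v - M x v) + (\<Sum>j\<in>{1..<i}. ext_a \<nu> a b i j *
       (h / \<epsilon> * (P_op B \<mu> (F j) x v - \<mu> * M x v - \<epsilon> * transport (F j) x v)
         * exp (ext_c \<nu> a j * (\<mu> * h / \<epsilon>))))"
proof (cases "i = \<nu> + 1")
  case True
  have "{1..<\<nu>+1} = {1..\<nu>}" by auto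
  with True show ?thesis
    using step by (simp add: ExpRKF_step_def Let_def ext_c_def ext_a_def mult.assoc)
next
  case False
  with i have "i \<in> {1..\<nu>}" by auto
  then show ?thesis
    using step False by (simp add: ExpRKF_step_def Let_def ext_a_def mult.assoc)
qed

section \<open>Signs of the individual terms\<close>

lemma equilibrium_weight_nonneg:
  fixes \<alpha> c :: "'i \<Rightarrow> real"
  assumes "\<And>j. j \<in> J \<Longrightarrow> \<alpha> j \<ge> 0" and sum1: "(\<Sum>j\<in>J. \<alpha> j) = 1"
  shows "(\<Sum>j\<in>J. \<alpha> j * exp (c j * l) * (1 + (d - c j) * l)) \<le> exp (d * l)"
proof -
  have "\<alpha> j * exp (c j * l) * (1 + (d - c j) * l) \<le> \<alpha> j * exp (d * l)" if "j \<in> J" for j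
  proof -
    have "exp (c j * l) * (1 + (d - c j) * l) \<le> exp (c j * l) * exp ((d - c j) * l)"
      using exp_ge_add_one_self by (rule mult_left_mono) simp
    also have "\<dots> = exp (d * l)"
      by (simp add: exp_add[symmetric] algebra_simps)
    finally show ?thesis
      using assms(1)[OF that] by (simp add: mult.assoc mult_left_mono)
  qed
  then have "(\<Sum>j\<in>J. \<alpha> j * exp (c j * l) * (1 + (d - c j) * l)) \<le> (\<Sum>j\<in>J. \<alpha> j * exp (d * l))"
    by (rule sum_mono)
  also have "\<dots> = exp (d * l)"
    by (simp add: sum_distrib_right[symmetric] sum1)
  finally show ?thesis .
qed

text \<open>
  A weight \<open>\<alpha> > 0\<close> forces the step length \<open>d\<close> to be nonnegative, because \<open>\<alpha> d \<ge> 0\<close>: the expression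
  is then \<open>\<alpha>\<close> times a transport step. For \<open>\<alpha> = 0\<close> it vanishes, whatever the sign of \<open>d\<close>.
\<close>

lemma transport_stage_nonneg:
  assumes transport: "\<And>h. 0 < h \<Longrightarrow> h \<le> h1 \<Longrightarrow> nonneg (\<lambda>x v. f x v - h * transport f x v)"
    and f: "nonneg f" and "\<alpha> \<ge> 0" "\<alpha> * d \<ge> 0" "h > 0" "h * d \<le> h1"
  shows "0 \<le> \<alpha> * f x v - h * (\<alpha> * d) * transport f x v"
proof -
  have "0 \<le> f x v - h * d * transport f x v" if "\<alpha> > 0"
  proof -
    have "d \<ge> 0" using that assms by (simp add: zero_le_mult_iff)
    then show ?thesis
      using transport[of "h * d"] f assms by (cases "d = 0") (auto simp: nonneg_def)
  qed
  then have "0 \<le> \<alpha> * (f x v - h * d * transport f x v)"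
    using \<open>\<alpha> \<ge> 0\<close> by (cases "\<alpha> = 0") auto
  then show ?thesis by (simp add: algebra_simps)
qed

section \<open>Positivity of the scheme\<close>

theorem theorem1:
  fixes \<nu> :: nat
    and a \<alpha> \<beta> :: "nat \<Rightarrow> nat \<Rightarrow> real" and b :: "nat \<Rightarrow> real"
    and B :: "real \<Rightarrow> 'a::euclidean_space \<Rightarrow> real"
    and M :: "'a phase" and \<epsilon> :: real and \<F> :: "'a phase set"
  assumes eps: "\<epsilon> > 0"
    and kernel_nonneg: "\<And>r \<omega>. r \<ge> 0 \<Longrightarrow> norm \<omega> = 1 \<Longrightarrow> B r \<omega> \<ge> 0"
    and equilibrium_nonneg: "nonneg M"
    and consistent: "(\<Sum>i\<in>{1..\<nu>}. b i) = 1"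
    and representation: "shu_osher \<nu> a b \<alpha> \<beta>"
    and alpha_nonneg: "\<And>i j. 1 \<le> j \<Longrightarrow> j < i \<Longrightarrow> i \<le> \<nu> + 1 \<Longrightarrow> \<alpha> i j \<ge> 0"
    and beta_nonneg: "\<And>i j. 1 \<le> j \<Longrightarrow> j < i \<Longrightarrow> i \<le> \<nu> + 1 \<Longrightarrow> \<beta> i j \<ge> 0"
    and regular: "\<And>f. f \<in> \<F> \<Longrightarrow> regular B f"
    and transport: "transport_assumption \<F>"
    and loss_bounded: "\<exists>C. \<forall>f\<in>\<F>. nonneg f \<longrightarrow> (\<forall>x v. loss_Q B f x v \<le> C)"
  shows "\<exists>h0>0. \<exists>\<mu>0>0. \<forall>h \<mu> fn F fn1.
    0 < h \<and> h \<le> h0 \<and> \<mu> \<ge> \<mu>0 \<and> nonneg fn \<and>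
    ExpRKF_step \<nu> a b B M \<epsilon> \<mu> h fn F fn1 \<and> (\<forall>i\<in>{1..\<nu>}. F i \<in> \<F>) \<longrightarrow>
    nonneg fn1"
proof -
  define c where "c = ext_c \<nu> a"
  obtain h1 where h1: "h1 > 0" and tr: "\<And>f h. f \<in> \<F> \<Longrightarrow> nonneg f \<Longrightarrow> 0 < h \<Longrightarrow> h \<le> h1 \<Longrightarrow>
      nonneg (\<lambda>x v. f x v - h * transport f x v)"
    using transport unfolding transport_assumption_def by blast
  obtain C where C: "\<And>f x v. f \<in> \<F> \<Longrightarrow> nonneg f \<Longrightarrow> loss_Q B f x v \<le> C"
    using loss_bounded by blast
  \<comment> \<open>a positive bound for all the differences \<open>c\<^sub>i - c\<^sub>j\<close>, i.e. for the relative lengths of the Euler steps\<close>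
  define D where "D = 1 + 2 * (\<Sum>k\<in>{1..\<nu>+1}. \<bar>c k\<bar>)"
  have D: "D > 0"
    unfolding D_def by (intro add_pos_nonneg mult_nonneg_nonneg sum_nonneg) auto
  have c_diff: "c i - c j \<le> D" if "i \<in> {1..\<nu>+1}" "j \<in> {1..\<nu>+1}" for i j
  proof -
    have "\<bar>c k\<bar> \<le> (\<Sum>k\<in>{1..\<nu>+1}. \<bar>c k\<bar>)" if "k \<in> {1..\<nu>+1}" for k
      using that by (intro member_le_sum) auto
    from this[OF that(1)] this[OF that(2)] show ?thesis
      unfolding D_def by linarith
  qed
  \<comment> \<open>\<open>c\<^sub>1\<close> is an empty sum and not the value \<open>1\<close> of the update row, because there is a stage\<close>
  have "\<nu> \<noteq> 0"
    using consistent by (cases "\<nu> = 0") auto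
  then have c1: "c 1 = 0"
    by (simp add: c_def ext_c_def)
  have "nonneg fn1"
    if h: "0 < h" "h \<le> h1 / D" and \<mu>: "max C 1 \<le> \<mu>" and fn: "nonneg fn"
      and step: "ExpRKF_step \<nu> a b B M \<epsilon> \<mu> h fn F fn1" and F: "\<forall>i\<in>{1..\<nu>}. F i \<in> \<F>"
    for h \<mu> fn F fn1
  proof -
    define F' where "F' = F(\<nu>+1 := fn1)"
    define l where "l = \<mu> * h / \<epsilon>"
    have hD: "h * d \<le> h1" if "d \<le> D" for d
    proof -
      have "h * d \<le> h * D" using that h by simp
      also have "\<dots> \<le> h1" using h D by (simp add: pos_le_divide_eq)
      finally show ?thesis .
    qed
    have "nonneg (F' i)" if "i \<in> {1..\<nu>+1}" for i
      using that
    proof (induction i rule: less_induct)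
      case (less i)
      have "0 \<le> F' i x v" for x v
      proof (cases "i = 1")
        case True
        then have "(F' i x v - M x v) * exp (c i * l) = fn x v - M x v"
          using ExpRKF_step_stage[OF step less.prems, of x v] by (simp add: F'_def c_def l_def)
        then show ?thesis
          using True c1 fn by (simp add: nonneg_def)
      next
        case False
        with less.prems have i: "i \<in> {2..\<nu>+1}" by auto
        have \<alpha>1: "(\<Sum>j\<in>{1..<i}. \<alpha> i j) = 1"
          and \<beta>: "\<And>j. j \<in> {1..<i} \<Longrightarrow> \<beta> i j = \<alpha> i j * (c i - c j)"
          using representation i unfolding shu_osher_def c_def by blast+
        define E where "E j = exp (c j * l)" for j
        define G where "G j = P_op B \<mu> (F j) x v - \<mu> * M x v - \<epsilon> * transport (F j) x v" for j
        define T where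
          "T j = \<alpha> i j * F j x v - h * \<beta> i j * transport (F j) x v + h / \<epsilon> * \<beta> i j * P_op B \<mu> (F j) x v" for j
        define W where "W = (\<Sum>j\<in>{1..<i}. \<alpha> i j * E j * (1 + (c i - c j) * l))"
        have T: "0 \<le> T j" if j: "j \<in> {1..<i}" for j
        proof -
          have "j \<in> {1..\<nu>}" "j \<in> {1..\<nu>+1}" using j i by auto
          then have Fj: "F j \<in> \<F>" and "F' j = F j" using F by (auto simp: F'_def)
          then have pos: "nonneg (F j)"
            using less.IH[of j] j \<open>j \<in> {1..\<nu>+1}\<close> by auto
          have \<alpha>0: "\<alpha> i j \<ge> 0" and \<beta>0: "\<beta> i j \<ge> 0"
            using alpha_nonneg beta_nonneg i j by auto
          have "0 \<le> \<alpha> i j * F j x v - h * \<beta> i j * transport (F j) x v"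
            unfolding \<beta>[OF j]
          proof (rule transport_stage_nonneg)
            show "\<alpha> i j * (c i - c j) \<ge> 0" using \<beta>0 \<beta>[OF j] by simp
            show "h * (c i - c j) \<le> h1"
              using c_diff[OF less.prems \<open>j \<in> {1..\<nu>+1}\<close>] by (rule hD)
          qed (use tr[OF Fj pos] pos \<alpha>0 h in auto)
          moreover have "0 \<le> P_op B \<mu> (F j) x v"
            using kernel_nonneg regular[OF Fj] pos
          proof (rule P_op_nonneg)
            show "loss_Q B (F j) x v \<le> \<mu>" using C[OF Fj pos, of x v] \<mu> by simp
          qed
          ultimately show ?thesis
            unfolding T_def using \<beta>0 h eps by simp
        qed
        have "(F' i x v - M x v) * E i
            = (\<Sum>j\<in>{1..<i}. \<alpha> i j * ((F' j x v - M x v) * E j) + \<beta> i j * (h / \<epsilon> * G j * E j))"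
          using representation ExpRKF_step_stage[OF step] i unfolding F'_def E_def G_def c_def l_def
          by (rule shu_osher_form)
        also have "\<dots> = (\<Sum>j\<in>{1..<i}. E j * T j - M x v * (\<alpha> i j * E j * (1 + (c i - c j) * l)))"
        proof (rule sum.cong)
          fix j assume j: "j \<in> {1..<i}"
          then have "F' j = F j" using i by (auto simp: F'_def)
          have "h / \<epsilon> * G j = h / \<epsilon> * P_op B \<mu> (F j) x v - h * transport (F j) x v - M x v * l"
            using eps by (simp add: G_def l_def field_simps)
          then have "\<beta> i j * (h / \<epsilon> * G j) = \<beta> i j *
              (h / \<epsilon> * P_op B \<mu> (F j) x v - h * transport (F j) x v - M x v * l)"
            by simp
          also have "\<dots> = h / \<epsilon> * \<beta> i j * P_op B \<mu> (F j) x v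
              - h * \<beta> i j * transport (F j) x v - M x v * \<alpha> i j * ((c i - c j) * l)"
            unfolding right_diff_distrib by (simp add: \<beta>[OF j])
          finally have "\<alpha> i j * (F j x v - M x v) + \<beta> i j * (h / \<epsilon> * G j)
              = T j - M x v * \<alpha> i j * (1 + (c i - c j) * l)"
            by (simp add: T_def algebra_simps)
          then have "E j * (\<alpha> i j * (F j x v - M x v) + \<beta> i j * (h / \<epsilon> * G j))
              = E j * (T j - M x v * \<alpha> i j * (1 + (c i - c j) * l))"
            by simp
          then show "\<alpha> i j * ((F' j x v - M x v) * E j) + \<beta> i j * (h / \<epsilon> * G j * E j)
              = E j * T j - M x v * (\<alpha> i j * E j * (1 + (c i - c j) * l))"
            unfolding \<open>F' j = F j\<close> by (simp only: algebra_simps)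
        qed simp
        also have "\<dots> = (\<Sum>j\<in>{1..<i}. E j * T j) - M x v * W"
          by (simp only: W_def sum_subtractf sum_distrib_left)
        finally have "F' i x v * E i = (\<Sum>j\<in>{1..<i}. E j * T j) + M x v * (E i - W)"
          by (simp add: algebra_simps)
        moreover have "0 \<le> (\<Sum>j\<in>{1..<i}. E j * T j)"
          using T by (intro sum_nonneg mult_nonneg_nonneg) (auto simp: E_def)
        moreover have "W \<le> E i"
          unfolding W_def E_def
          using \<alpha>1 alpha_nonneg i by (intro equilibrium_weight_nonneg) auto
        ultimately have "0 \<le> F' i x v * E i"
          using equilibrium_nonneg by (simp add: nonneg_def)
        then show ?thesis
          by (simp add: E_def zero_le_mult_iff)
      qed
      then show ?case by (simp add: nonneg_def)
    qed
    from this[of "\<nu>+1"] show ?thesis by (simp add: F'_def)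
  qed
  then show ?thesis
    using h1 D by (intro exI[of _ "h1 / D"] exI[of _ "max C 1"] conjI) (auto simp del: max.bounded_iff)
qed

end
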